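(* For every integer $a\ge 2$, the set $\mathcal{R}_a$ has exactly $8$ neighbors in its periodic tiling, while $\mathcal{G}_a$ has exactly $6$ neighbors in its periodic tiling. That is, there are exactly $8$ nonzero elements $v\in \mathbb{Z}(\alpha-1)+\mathbb{Z}\alpha(\alpha-1)$ with $\mathcal{R}_a\cap(\mathcal{R}_a+v)\neq\emptyset$, and exactly $6$ nonzero elements $v\in\mathbb{Z}+\mathbb{Z}\alpha$ with $\mathcal{G}_a\cap(\mathcal{G}_a+v)\neq\emptyset$.
   Context: Let $a\ge2$ be an integer and write $x^3-ax^2+x-1=(x-\beta)(x-\alpha)(x-\gamma)$ with $\beta>1$ real and $\alpha,\gamma\in\mathbb{C}\setminus\mathbb{R}$ complex conjugates, $|\alpha|<1$. $<_{lex}$ is the lexicographic order on finite words of equal length over $\{0,\dots,a-1\}$. $\mathcal{R}_a$ is the set of all $\sum_{i=2}^\infty a_i\alpha^i$ with $a_i\in\{0,\dots,a-1\}$ and $a_ia_{i-1}a_{i-2}a_{i-3}<_{lex}(a-1)(a-1)01$ for all $i\ge2$, where $a_1=a_0=a_{-1}=0$. $\mathcal{G}_a$ is the set of all $\sum_{i=2}^\infty a_i\alpha^i$ such that for all $N\ge2$ the word $(a_i)_{2\le i\le N}$ is a greedy $G$-expansion, i.e. $a_i\in\{0,\dots,a-1\}$, $a_ia_{i-1}a_{i-2}a_{i-3}<_{lex}(a-1)(a-1)01$ for all $i\ge5$, and $a_3a_2<_{lex}(a-1)(a-1)$, $a_4a_3a_2<_{lex}(a-1)(a-1)0$. $\mathcal{R}_a$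 tiles $\mathbb{C}$ periodically by translations in $\mathbb{Z}(\alpha-1)+\mathbb{Z}\alpha(\alpha-1)$, and $\mathcal{G}_a$ by translations in $\mathbb{Z}+\mathbb{Z}\alpha$. A neighbor of a tile is a different tile of the tiling that meets it. *)

theory Defs
  imports "HOL-Analysis.Analysis"
begin

text \<open>Strict lexicographic order on words over \<open>\<nat>\<close>; \<open>lex\<close> only relates lists of equal length.\<close>

definition lex_less :: "nat list \<Rightarrow> nat list \<Rightarrow> bool" (infix "<\<^sub>l\<^sub>e\<^sub>x" 50)
  where "u <\<^sub>l\<^sub>e\<^sub>x w \<longleftrightarrow> (u, w) \<in> lex less_than"

text \<open>Digit sequences are indexed by integers, so that the index \<open>-1\<close> needs no special
  treatment. Only the digits with index at least 2 contribute to the value.\<close>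

definition expansion :: "complex \<Rightarrow> (int \<Rightarrow> nat) \<Rightarrow> complex"
  where "expansion \<alpha> d = (\<Sum>k. of_nat (d (int (k + 2))) * \<alpha> ^ (k + 2))"

definition R_tile :: "nat \<Rightarrow> complex \<Rightarrow> complex set"
  where "R_tile a \<alpha> = {expansion \<alpha> d | d.
    d 1 = 0 \<and> d 0 = 0 \<and> d (-1) = 0 \<and>
    (\<forall>i\<ge>2. d i \<in> {0..a - 1} \<and>
       [d i, d (i - 1), d (i - 2), d (i - 3)] <\<^sub>l\<^sub>e\<^sub>x [a - 1, a - 1, 0, 1])}"

text \<open>\<open>greedy_G a N d\<close>: the finite word \<open>(d i)\<close>, \<open>2 \<le> i \<le> N\<close>, is a greedy \<open>G\<close>-expansion.
  A condition applies only if all digits it mentions belong to the word.\<close>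

definition greedy_G :: "nat \<Rightarrow> int \<Rightarrow> (int \<Rightarrow> nat) \<Rightarrow> bool"
  where "greedy_G a N d \<longleftrightarrow>
    (\<forall>i\<in>{2..N}. d i \<in> {0..a - 1}) \<and>
    (\<forall>i\<in>{5..N}. [d i, d (i - 1), d (i - 2), d (i - 3)] <\<^sub>l\<^sub>e\<^sub>x [a - 1, a - 1, 0, 1]) \<and>
    (3 \<le> N \<longrightarrow> [d 3, d 2] <\<^sub>l\<^sub>e\<^sub>x [a - 1, a - 1]) \<and>
    (4 \<le> N \<longrightarrow> [d 4, d 3, d 2] <\<^sub>l\<^sub>e\<^sub>x [a - 1, a - 1, 0])"

definition G_tile :: "nat \<Rightarrow> complex \<Rightarrow> complex set"
  where "G_tile a \<alpha> = {expansion \<alpha> d | d. \<forall>N\<ge>2. greedy_G a N d}"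

definition int_span2 :: "complex \<Rightarrow> complex \<Rightarrow> complex set"
  where "int_span2 u w = {of_int m * u + of_int n * w | m n. True}"

definition translate :: "complex set \<Rightarrow> complex \<Rightarrow> complex set"
  where "translate T v = (\<lambda>z. z + v) ` T"

text \<open>Neighbors of \<open>T\<close> in the collection \<open>{T + v | v \<in> L}\<close>, as sets.\<close>

definition neighbors :: "complex set \<Rightarrow> complex set \<Rightarrow> complex set set"
  where "neighbors T L = {S \<in> translate T ` L. S \<noteq> T \<and> T \<inter> S \<noteq> {}}"

definition neighbor_vectors :: "complex set \<Rightarrow> complex set \<Rightarrow> complex set"
  where "neighbor_vectors T L = {v \<in> L. v \<noteq> 0 \<and> T \<inter> translate T v \<noteq> {}}"

end

theory Submission
  imports Defs
begin

text \<open>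
  Put \<open>P(x) = x\<^sup>3 - a x\<^sup>2 + x - 1\<close>. A tile meets its translate by \<open>v\<close> iff \<open>v\<close> is the value at
  \<open>\<alpha>\<close> of a difference \<open>e = c - d\<close> of two admissible digit sequences. The power series
  \<open>\<Sum>k. e k * x ^ (k + 2)\<close> minus a polynomial representing \<open>v\<close> then vanishes at the two roots
  \<open>\<alpha>\<close>, \<open>cnj \<alpha>\<close> of \<open>P\<close> inside the unit disc, so its quotient by \<open>P\<close> is a power series with
  bounded integer coefficients. These are the carries \<open>u 1, u 2, \<dots>\<close>, preceded by \<open>u 0\<close>, the
  quadratic coefficient of the polynomial representing \<open>v\<close>. Hence the neighbors correspond to the bounded
  integer sequences \<open>u\<close> for which the numbers
  \<open>u n - a * u (n + 1) + u (n + 2) - u (n + 3)\<close> are differences of admissible digits, and \<open>v\<close> is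
  determined by \<open>u 0\<close>, \<open>u 1\<close>, \<open>u 2\<close> (lemma \<open>tile_meets_translate\<close>). Membership of \<open>v\<close> in the
  translation lattice becomes \<open>u 0 = - u 2\<close> for the first tile and \<open>u 0 = 0\<close> for the second,
  so that \<open>u 1\<close> and \<open>u 2\<close> are free coordinates on the lattice.

  The digit differences are at most \<open>a - 1\<close> in absolute value, whereas the coefficient \<open>a\<close>
  dominates the other ones. For \<open>a \<ge> 5\<close> this forces \<open>\<bar>u n\<bar> \<le> 1\<close>; for \<open>a = 2, 3, 4\<close> it gives
  explicit bounds, after which finitely many starting values remain to be excluded by a finite
  search (lemmas \<open>R_carry_starts\<close>, \<open>G_carry_starts\<close>). In all cases \<open>u 1, u 2 \<in> {-1, 0, 1}\<close>, and for
  the second tile the two pairs \<open>(1, -1)\<close>, \<open>(-1, 1)\<close> are impossible.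

  Conversely each of the remaining pairs occurs: sequences with \<open>u (n + 2) = - u n\<close> have digit
  differences \<open>- (a - 1) * u (n + 1)\<close> (for the second tile with an exception at \<open>n = 0\<close>), and their positive and negative parts are admissible
  (lemmas \<open>R_carry_exists\<close>, \<open>G_carry_exists\<close>). This leaves \<open>9 - 1 = 8\<close> and \<open>7 - 1 = 6\<close> nonzero vectors.
\<close>

section \<open>Translates of a bounded set\<close>

text \<open>Iterating the translation by \<open>v - w\<close> would move a point of \<open>T\<close> arbitrarily far away inside
  \<open>T\<close>. Thus distinct vectors give distinct tiles, and counting neighbors is counting vectors.\<close>

lemma translate_inj:
  assumes "bounded T" "T \<noteq> {}" "translate T v = translate T w"
  shows "v = w"
proof (rule ccontr)
  assume "v \<noteq> w"
  have step: "x + (v - w) \<in> T" if "x \<in> T" for x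
  proof -
    have "x + v \<in> translate T w"
      using that assms(3) unfolding translate_def by blast
    then obtain y where "y \<in> T" "x + v = y + w"
      unfolding translate_def by blast
    then show ?thesis
      by (metis add_diff_cancel_right' add_diff_eq)
  qed
  obtain x where "x \<in> T"
    using assms(2) by blast
  have orbit: "x + of_nat n * (v - w) \<in> T" for n
  proof (induction n)
    case (Suc n)
    then show ?case
      using step[OF Suc] by (simp add: algebra_simps)
  qed (use \<open>x \<in> T\<close> in simp)
  obtain B where B: "\<And>y. y \<in> T \<Longrightarrow> norm y \<le> B"
    using assms(1) bounded_iff by blast
  obtain n :: nat where n: "of_nat n * norm (v - w) > 2 * B"
    using \<open>v \<noteq> w\<close> reals_Archimedean3[of "norm (v - w)"] by auto
  have "of_nat n * norm (v - w) = norm ((x + of_nat n * (v - w)) - x)"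
    by (simp add: norm_mult)
  also have "\<dots> \<le> B + B"
    by (intro order_trans[OF norm_triangle_ineq4] add_mono B orbit \<open>x \<in> T\<close>)
  finally show False
    using n by simp
qed

lemma card_neighbors:
  assumes "bounded T" "T \<noteq> {}"
  shows "card (neighbors T L) = card (neighbor_vectors T L)"
proof -
  have zero: "translate T 0 = T"
    by (simp add: translate_def)
  have "neighbors T L = translate T ` neighbor_vectors T L"
    unfolding neighbors_def neighbor_vectors_def
    using translate_inj[OF assms, of _ 0] zero by auto
  moreover have "inj_on (translate T) (neighbor_vectors T L)"
    by (rule inj_onI) (rule translate_inj[OF assms])
  ultimately show ?thesis
    by (simp add: card_image)
qed

section \<open>Admissible digit sequences\<close>

text \<open>The entry \<open>c n\<close> is the digit with index \<open>n + 2\<close>. For digits up to \<open>a - 1\<close> the condition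
  \<open>wxyz <\<^sub>l\<^sub>e\<^sub>x (a-1)(a-1)01\<close> says that \<open>w = x = a - 1\<close> implies \<open>y = z = 0\<close>.\<close>

definition R_admissible :: "nat \<Rightarrow> (nat \<Rightarrow> nat) \<Rightarrow> bool"
  where "R_admissible a c \<longleftrightarrow> (\<forall>n. c n \<le> a - 1) \<and>
    (\<forall>n m. c n = a - 1 \<and> c (n + 1) = a - 1 \<and> m < n \<and> n \<le> m + 2 \<longrightarrow> c m = 0)"

text \<open>The shorter words at the start of a greedy expansion behave as if the nonexistent digits
  with index below 2 were nonzero: there, two top digits in a row are forbidden altogether.\<close>

definition G_admissible :: "nat \<Rightarrow> (nat \<Rightarrow> nat) \<Rightarrow> bool"
  where "G_admissible a c \<longleftrightarrow> R_admissible a c \<and>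
    (\<forall>n<2. \<not> (c n = a - 1 \<and> c (n + 1) = a - 1))"

definition digit_value :: "complex \<Rightarrow> (nat \<Rightarrow> nat) \<Rightarrow> complex"
  where "digit_value \<alpha> c = (\<Sum>k. of_nat (c k) * \<alpha> ^ (k + 2))"

lemma R_admissible_le: "R_admissible a c \<Longrightarrow> c n \<le> a - 1"
  unfolding R_admissible_def by blast

lemma G_admissible_le: "G_admissible a c \<Longrightarrow> c n \<le> a - 1"
  unfolding G_admissible_def by (blast intro: R_admissible_le)

lemma lex_less_iff:
  assumes "x \<le> b" "y \<le> b"
  shows "[x, y, z, w] <\<^sub>l\<^sub>e\<^sub>x [b, b, 0, 1] \<longleftrightarrow> (x = b \<and> y = b \<longrightarrow> z = 0 \<and> w = 0)"
  using assms by (auto simp: lex_less_def)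

lemma lex_less_iff2:
  assumes "x \<le> b" "y \<le> b"
  shows "[x, y] <\<^sub>l\<^sub>e\<^sub>x [b, b] \<longleftrightarrow> \<not> (x = b \<and> y = b)"
  using assms by (auto simp: lex_less_def)

lemma lex_less_iff3:
  assumes "x \<le> b" "y \<le> b"
  shows "[x, y, z] <\<^sub>l\<^sub>e\<^sub>x [b, b, 0] \<longleftrightarrow> \<not> (x = b \<and> y = b)"
  using assms by (auto simp: lex_less_def)

lemma lex_window:
  fixes d :: "int \<Rightarrow> nat" and n :: int
  assumes "[d (n + 3), d (n + 3 - 1), d (n + 3 - 2), d (n + 3 - 3)] <\<^sub>l\<^sub>e\<^sub>x [b, b, 0, 1]"
    and "d (n + 2) = b" "d (n + 3) = b"
  shows "d (n + 1) = 0 \<and> d n = 0"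
proof -
  have shifts: "n + 3 - 1 = n + 2" "n + 3 - 2 = n + 1" "n + 3 - 3 = n"
    by simp_all
  have "[d (n + 3), d (n + 2), d (n + 1), d n] <\<^sub>l\<^sub>e\<^sub>x [b, b, 0, 1]"
    using assms(1) unfolding shifts .
  then show ?thesis
    using assms(2,3) lex_less_iff[of b b b] by simp
qed

definition shift_digits :: "(nat \<Rightarrow> nat) \<Rightarrow> int \<Rightarrow> nat"
  where "shift_digits c i = (if i \<ge> 2 then c (nat (i - 2)) else 0)"

lemma expansion_eq: "expansion \<alpha> d = digit_value \<alpha> (\<lambda>k. d (int k + 2))"
  by (simp only: expansion_def digit_value_def of_nat_add of_nat_numeral)

lemma expansion_shift_digits: "expansion \<alpha> (shift_digits c) = digit_value \<alpha> c"
  by (simp add: expansion_eq shift_digits_def)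

lemma R_tile_eq:
  assumes "a \<ge> 2"
  shows "R_tile a \<alpha> = {digit_value \<alpha> c | c. R_admissible a c}"
proof (intro equalityI subsetI)
  fix z assume "z \<in> R_tile a \<alpha>"
  then obtain d where z: "z = expansion \<alpha> d" and
    dig: "\<And>i. i \<ge> 2 \<Longrightarrow> d i \<le> a - 1" and
    lx: "\<And>i. i \<ge> 2 \<Longrightarrow> [d i, d (i - 1), d (i - 2), d (i - 3)] <\<^sub>l\<^sub>e\<^sub>x [a - 1, a - 1, 0, 1]"
    unfolding R_tile_def by auto
  have rule: "d (int n + 1) = 0 \<and> d (int n) = 0"
    if "d (int n + 2) = a - 1" "d (int n + 3) = a - 1" for n
    using lex_window[of d "int n" "a - 1"] lx[of "int n + 3"] that by simp
  have "R_admissible a (\<lambda>k. d (int k + 2))"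
    unfolding R_admissible_def
  proof (intro conjI allI impI)
    fix n m assume *: "d (int n + 2) = a - 1 \<and> d (int (n + 1) + 2) = a - 1 \<and> m < n \<and> n \<le> m + 2"
    then have "d (int n + 3) = a - 1"
      by (simp add: algebra_simps)
    with * have "d (int n + 1) = 0 \<and> d (int n) = 0"
      using rule by blast
    moreover have "int m + 2 = int n + 1 \<or> int m + 2 = int n"
      using * by linarith
    then have "d (int m + 2) = d (int n + 1) \<or> d (int m + 2) = d (int n)"
      using arg_cong[of "int m + 2" "int n + 1" d] arg_cong[of "int m + 2" "int n" d] by blast
    ultimately show "d (int m + 2) = 0"
      by auto
  qed (use dig in auto)
  then show "z \<in> {digit_value \<alpha> c | c. R_admissible a c}"
    using z expansion_eq by blast
next
  fix z assume "z \<in> {digit_value \<alpha> c | c. R_admissible a c}"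
  then obtain c where z: "z = digit_value \<alpha> c" and c: "R_admissible a c"
    by blast
  let ?d = "shift_digits c"
  have dig: "?d i \<le> a - 1" for i
    unfolding shift_digits_def using R_admissible_le[OF c] by simp
  have "[?d i, ?d (i - 1), ?d (i - 2), ?d (i - 3)] <\<^sub>l\<^sub>e\<^sub>x [a - 1, a - 1, 0, 1]" if "i \<ge> 2" for i
    unfolding lex_less_iff[OF dig dig]
  proof
    assume *: "?d i = a - 1 \<and> ?d (i - 1) = a - 1"
    have "i \<ge> 3"
    proof (rule ccontr)
      assume "\<not> i \<ge> 3"
      then have "?d (i - 1) = 0"
        by (simp add: shift_digits_def)
      then show False
        using * assms by linarith
    qed
    define n where "n = nat (i - 3)"
    have i: "i = int n + 3"
      using \<open>i \<ge> 3\<close> n_def by simp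
    have "c n = a - 1" "c (n + 1) = a - 1"
      using * by (auto simp: i shift_digits_def nat_add_distrib)
    then have zero: "m < n \<Longrightarrow> n \<le> m + 2 \<Longrightarrow> c m = 0" for m
      using c unfolding R_admissible_def by blast
    show "?d (i - 2) = 0 \<and> ?d (i - 3) = 0"
      unfolding i shift_digits_def using zero[of "n - 1"] zero[of "n - 2"]
      by (auto simp: nat_diff_distrib')
  qed
  then show "z \<in> R_tile a \<alpha>"
    unfolding R_tile_def z expansion_shift_digits[symmetric]
    by (intro CollectI exI[of _ ?d]) (simp add: dig[simplified]; simp add: shift_digits_def)
qed

lemma G_tile_eq: "G_tile a \<alpha> = {digit_value \<alpha> c | c. G_admissible a c}"
proof (intro equalityI subsetI)
  fix z assume "z \<in> G_tile a \<alpha>"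
  then obtain d where z: "z = expansion \<alpha> d" and gr: "\<And>N. N \<ge> 2 \<Longrightarrow> greedy_G a N d"
    unfolding G_tile_def by auto
  have dig: "d i \<le> a - 1" if "i \<ge> 2" for i
    using gr[of i] that by (auto simp: greedy_G_def)
  have lx: "[d i, d (i - 1), d (i - 2), d (i - 3)] <\<^sub>l\<^sub>e\<^sub>x [a - 1, a - 1, 0, 1]" if "i \<ge> 5" for i
  proof -
    have "greedy_G a i d"
      using gr that by simp
    then have "\<forall>k\<in>{5..i}. [d k, d (k - 1), d (k - 2), d (k - 3)] <\<^sub>l\<^sub>e\<^sub>x [a - 1, a - 1, 0, 1]"
      unfolding greedy_G_def by (elim conjE)
    then show ?thesis
      by (rule bspec) (use that in simp)
  qed
  have rule: "d (int n + 1) = 0 \<and> d (int n) = 0"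
    if "d (int n + 2) = a - 1" "d (int n + 3) = a - 1" "n \<ge> 2" for n
    using lex_window[of d "int n" "a - 1"] lx[of "int n + 3"] that by simp
  have start: "\<not> (d 2 = a - 1 \<and> d 3 = a - 1)" "\<not> (d 3 = a - 1 \<and> d 4 = a - 1)"
    using gr[of 4] lex_less_iff2[of "d 3" "a - 1" "d 2"] lex_less_iff3[of "d 4" "a - 1" "d 3" "d 2"]
      dig by (auto simp: greedy_G_def)
  have "R_admissible a (\<lambda>k. d (int k + 2))"
    unfolding R_admissible_def
  proof (intro conjI allI impI)
    fix n m assume *: "d (int n + 2) = a - 1 \<and> d (int (n + 1) + 2) = a - 1 \<and> m < n \<and> n \<le> m + 2"
    then have n3: "d (int n + 3) = a - 1"
      by (simp add: algebra_simps)
    have "n \<ge> 2"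
    proof (rule ccontr)
      assume "\<not> n \<ge> 2"
      then have "n = 0 \<or> n = 1"
        by auto
      then show False
        using * n3 start by auto
    qed
    with * n3 have "d (int n + 1) = 0 \<and> d (int n) = 0"
      using rule by blast
    moreover have "int m + 2 = int n + 1 \<or> int m + 2 = int n"
      using * by linarith
    then have "d (int m + 2) = d (int n + 1) \<or> d (int m + 2) = d (int n)"
      using arg_cong[of "int m + 2" "int n + 1" d] arg_cong[of "int m + 2" "int n" d] by blast
    ultimately show "d (int m + 2) = 0"
      by auto
  qed (use dig in auto)
  moreover have "\<forall>n<2. \<not> (d (int n + 2) = a - 1 \<and> d (int (n + 1) + 2) = a - 1)"
    using start by (auto simp: less_2_cases_iff)
  ultimately have "G_admissible a (\<lambda>k. d (int k + 2))"
    unfolding G_admissible_def by blast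
  then show "z \<in> {digit_value \<alpha> c | c. G_admissible a c}"
    using z expansion_eq by blast
next
  fix z assume "z \<in> {digit_value \<alpha> c | c. G_admissible a c}"
  then obtain c where z: "z = digit_value \<alpha> c" and c: "G_admissible a c"
    by blast
  let ?d = "shift_digits c"
  have dig: "?d i \<le> a - 1" for i
    unfolding shift_digits_def using G_admissible_le[OF c] by simp
  have lx: "[?d i, ?d (i - 1), ?d (i - 2), ?d (i - 3)] <\<^sub>l\<^sub>e\<^sub>x [a - 1, a - 1, 0, 1]" if "i \<ge> 5" for i
    unfolding lex_less_iff[OF dig dig]
  proof
    assume *: "?d i = a - 1 \<and> ?d (i - 1) = a - 1"
    define n where "n = nat (i - 3)"
    have i: "i = int n + 3"
      using \<open>i \<ge> 5\<close> n_def by simp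
    have "c n = a - 1" "c (n + 1) = a - 1"
      using * by (auto simp: i shift_digits_def nat_add_distrib)
    then have zero: "m < n \<Longrightarrow> n \<le> m + 2 \<Longrightarrow> c m = 0" for m
      using c unfolding G_admissible_def R_admissible_def by blast
    show "?d (i - 2) = 0 \<and> ?d (i - 3) = 0"
      unfolding i shift_digits_def using zero[of "n - 1"] zero[of "n - 2"]
      by (auto simp: nat_diff_distrib')
  qed
  have "\<not> (c 0 = a - 1 \<and> c 1 = a - 1)" "\<not> (c 1 = a - 1 \<and> c 2 = a - 1)"
    using c unfolding G_admissible_def
    by (auto simp: less_2_cases_iff numeral_2_eq_2)
  then have starts: "\<not> (?d 3 = a - 1 \<and> ?d 2 = a - 1)" "\<not> (?d 4 = a - 1 \<and> ?d 3 = a - 1)"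
    by (simp_all add: shift_digits_def conj_commute)
  have "greedy_G a N ?d" for N
    unfolding greedy_G_def lex_less_iff2[OF dig dig] lex_less_iff3[OF dig dig]
  proof (intro conjI ballI impI starts)
    show "?d i \<in> {0..a - 1}" for i
      using dig[of i] by simp
  qed (use lx in simp)
  then show "z \<in> G_tile a \<alpha>"
    unfolding G_tile_def z expansion_shift_digits[symmetric] by blast
qed

section \<open>Carry sequences\<close>

text \<open>The coefficient of \<open>x ^ (n + 3)\<close> in \<open>(x\<^sup>3 - a x\<^sup>2 + x - 1) * (\<Sum>n. u n * x ^ n)\<close>.\<close>

definition digit_diff :: "nat \<Rightarrow> (nat \<Rightarrow> int) \<Rightarrow> nat \<Rightarrow> int"
  where "digit_diff a u n = u n - int a * u (n + 1) + u (n + 2) - u (n + 3)"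

text \<open>The vector represented by carries with initial values \<open>p\<close>, \<open>q\<close>, \<open>r\<close>; it is \<open>1/\<alpha>\<close> times minus
  the part of degree at most 2 of the product above, simplified by the equation of \<open>\<alpha>\<close>.\<close>

definition carry_value :: "complex \<Rightarrow> int \<Rightarrow> int \<Rightarrow> int \<Rightarrow> complex"
  where "carry_value \<alpha> p q r = of_int p * \<alpha>\<^sup>2 + of_int q * (1 - \<alpha>) + of_int r * \<alpha>"

fun carries :: "nat \<Rightarrow> (nat \<Rightarrow> int) \<Rightarrow> int \<Rightarrow> int \<Rightarrow> int \<Rightarrow> nat \<Rightarrow> int"
  where
    "carries a e p q r 0 = p"
  | "carries a e p q r (Suc 0) = q"
  | "carries a e p q r (Suc (Suc 0)) = r"
  | "carries a e p q r (Suc (Suc (Suc n))) = carries a e p q r n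
      - int a * carries a e p q r (Suc n) + carries a e p q r (Suc (Suc n)) - e n"

lemma digit_diff_carries: "digit_diff a (carries a e p q r) n = e n"
  by (simp add: digit_diff_def numeral_2_eq_2 numeral_3_eq_3)

text \<open>The minimal equation of \<open>\<alpha>\<close> in terms of the elementary symmetric functions of its conjugates.\<close>

locale cubic_conjugates =
  fixes a :: nat and \<beta> :: real and \<alpha> :: complex
  assumes a_ge_2: "a \<ge> 2"
    and vieta1: "of_real \<beta> + \<alpha> + cnj \<alpha> = of_nat a"
    and vieta2: "of_real \<beta> * \<alpha> + of_real \<beta> * cnj \<alpha> + \<alpha> * cnj \<alpha> = 1"
    and vieta3: "of_real \<beta> * \<alpha> * cnj \<alpha> = 1"
    and beta_gt_1: "\<beta> > 1" and Im_alpha: "Im \<alpha> \<noteq> 0" and norm_alpha: "norm \<alpha> < 1"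
begin

text \<open>The polynomial \<open>P(x) / (x - \<alpha>) = (x - \<beta>) (x - cnj \<alpha>)\<close> in the shift operator, applied to \<open>u\<close>.
  Taking the factor \<open>x - \<beta>\<close> first exhibits two real numbers, of which the second can be read off
  from the imaginary part.\<close>

definition remainder :: "(nat \<Rightarrow> int) \<Rightarrow> nat \<Rightarrow> complex"
  where "remainder u n = of_real (of_int (u n) - \<beta> * of_int (u (n + 1)))
    - cnj \<alpha> * of_real (of_int (u (n + 1)) - \<beta> * of_int (u (n + 2)))"

lemma remainder_step:
  "remainder u n = of_int (digit_diff a u n) + \<alpha> * remainder u (n + 1)"
proof -
  have "remainder u n - \<alpha> * remainder u (n + 1) =
      of_int (u n) - (of_real \<beta> + \<alpha> + cnj \<alpha>) * of_int (u (n + 1))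
      + (of_real \<beta> * \<alpha> + of_real \<beta> * cnj \<alpha> + \<alpha> * cnj \<alpha>) * of_int (u (n + 2))
      - (of_real \<beta> * \<alpha> * cnj \<alpha>) * of_int (u (n + 3))"
    by (simp add: remainder_def algebra_simps numeral_3_eq_3)
  also have "\<dots> = of_int (digit_diff a u n)"
    unfolding vieta1 vieta2 vieta3 by (simp add: digit_diff_def)
  finally show ?thesis
    by (simp add: algebra_simps)
qed

lemma remainder_0: "carry_value \<alpha> (u 0) (u 1) (u 2) = \<alpha>\<^sup>2 * remainder u 0"
proof -
  have c1: "\<alpha>\<^sup>2 * (of_real \<beta> + cnj \<alpha>) = \<alpha> - 1"
    using vieta2 vieta3 by algebra
  have c2: "\<alpha>\<^sup>2 * (of_real \<beta> * cnj \<alpha>) = \<alpha>"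
    using vieta3 by algebra
  have "\<alpha>\<^sup>2 * remainder u 0 = of_int (u 0) * \<alpha>\<^sup>2
      - of_int (u 1) * (\<alpha>\<^sup>2 * (of_real \<beta> + cnj \<alpha>)) + of_int (u 2) * (\<alpha>\<^sup>2 * (of_real \<beta> * cnj \<alpha>))"
    by (simp add: remainder_def algebra_simps flip: numeral_2_eq_2)
  then show ?thesis
    unfolding c1 c2 carry_value_def by (simp add: algebra_simps)
qed

lemma partial_sum:
  "(\<Sum>k<n. of_int (digit_diff a u k) * \<alpha> ^ (k + 2))
    = carry_value \<alpha> (u 0) (u 1) (u 2) - \<alpha> ^ (n + 2) * remainder u n"
proof (induction n)
  case 0
  then show ?case
    using remainder_0[of u] by (simp add: power2_eq_square)
next
  case (Suc n)
  show ?case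
    unfolding sum.lessThan_Suc Suc.IH remainder_step[of u n] by (simp add: algebra_simps)
qed

text \<open>For bounded carries the remainder stays bounded, while the power of \<open>\<alpha>\<close> in front of it tends to 0.\<close>

lemma sums_carry_value:
  assumes "\<And>n. \<bar>u n\<bar> \<le> B"
  shows "(\<lambda>k. of_int (digit_diff a u k) * \<alpha> ^ (k + 2)) sums carry_value \<alpha> (u 0) (u 1) (u 2)"
proof -
  have ub: "\<bar>real_of_int (u n)\<bar> \<le> of_int B" for n
    using assms[of n] by linarith
  have w: "\<bar>of_int (u n) - \<beta> * of_int (u (n + 1))\<bar> \<le> of_int B + \<beta> * of_int B" for n
  proof -
    have "\<bar>of_int (u n) - \<beta> * of_int (u (n + 1))\<bar> \<le> \<bar>of_int (u n)\<bar> + \<beta> * \<bar>of_int (u (n + 1))\<bar>"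
      using abs_triangle_ineq4[of "of_int (u n)" "\<beta> * of_int (u (n + 1))"] beta_gt_1
      by (simp add: abs_mult)
    also have "\<dots> \<le> of_int B + \<beta> * of_int B"
      using beta_gt_1 by (intro add_mono ub mult_left_mono) auto
    finally show ?thesis .
  qed
  define K where "K = of_int B + \<beta> * of_int B"
  have K0: "K \<ge> 0"
    using w[of 0] abs_ge_zero order_trans unfolding K_def by blast
  have rem: "norm (remainder u n) \<le> 2 * K" for n
  proof -
    have "norm (remainder u n) \<le> \<bar>of_int (u n) - \<beta> * of_int (u (n + 1))\<bar>
        + norm \<alpha> * \<bar>of_int (u (n + 1)) - \<beta> * of_int (u (n + 1 + 1))\<bar>"
      unfolding remainder_def
      by (rule order_trans[OF norm_triangle_ineq4])
        (simp only: norm_mult norm_of_real complex_mod_cnj, simp)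
    also have "\<dots> \<le> K + 1 * K"
      using norm_alpha w K0 unfolding K_def by (intro add_mono mult_mono) auto
    finally show ?thesis
      by simp
  qed
  have "(\<lambda>n. norm \<alpha> ^ (n + 2) * (2 * K)) \<longlonglongrightarrow> 0"
    by (intro tendsto_mult_left_zero LIMSEQ_ignore_initial_segment LIMSEQ_power_zero)
      (use norm_alpha in simp)
  then have "(\<lambda>n. \<alpha> ^ (n + 2) * remainder u n) \<longlonglongrightarrow> 0"
    by (rule tendsto_0_le[where K = 1, OF _ eventuallyI])
       (use rem K0 in \<open>simp add: norm_mult norm_power mult_left_mono\<close>)
  then have "(\<lambda>n. carry_value \<alpha> (u 0) (u 1) (u 2) - \<alpha> ^ (n + 2) * remainder u n)
      \<longlonglongrightarrow> carry_value \<alpha> (u 0) (u 1) (u 2) - 0"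
    by (intro tendsto_intros)
  then show ?thesis
    unfolding sums_def partial_sum by simp
qed

text \<open>The tail of the series bounds the remainder, and since \<open>cnj \<alpha>\<close> is not real its imaginary part bounds \<open>u n - \<beta> * u (n + 1)\<close>. As \<open>\<beta> > 1\<close>, the latter makes
  \<open>u (n + 1)\<close> a contraction of \<open>u n\<close> up to a bounded error.\<close>

lemma bounded_carries:
  assumes e: "\<And>n. \<bar>digit_diff a u n\<bar> \<le> D"
    and s: "(\<lambda>k. of_int (digit_diff a u k) * \<alpha> ^ (k + 2)) sums carry_value \<alpha> (u 0) (u 1) (u 2)"
  obtains B where "\<And>n. \<bar>u n\<bar> \<le> B"
proof -
  let ?f = "\<lambda>k. of_int (digit_diff a u k) * \<alpha> ^ (k + 2)"
  have a0: "\<alpha> \<noteq> 0"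
    using Im_alpha by auto
  have D0: "D \<ge> 0"
    using e[of 0] by linarith
  define C where "C = of_int D / (1 - norm \<alpha>)"
  have rem: "norm (remainder u n) \<le> C" for n
  proof -
    have tail: "(\<lambda>k. ?f (k + n)) sums (\<alpha> ^ (n + 2) * remainder u n)"
      using sums_split_initial_segment[OF s, of n] unfolding partial_sum by simp
    have geo: "(\<lambda>k. norm \<alpha> ^ (n + 2) * (of_int D * norm \<alpha> ^ k)) sums (norm \<alpha> ^ (n + 2) * (of_int D * (1 / (1 - norm \<alpha>))))"
      using norm_alpha by (intro sums_mult geometric_sums) simp
    have le: "norm (?f (k + n)) \<le> norm \<alpha> ^ (n + 2) * (of_int D * norm \<alpha> ^ k)" for k
    proof -
      have "norm (?f (k + n)) = \<bar>of_int (digit_diff a u (k + n))\<bar> * (norm \<alpha> ^ (n + 2) * norm \<alpha> ^ k)"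
        by (simp add: norm_mult norm_power power_add algebra_simps)
      also have "\<dots> \<le> of_int D * (norm \<alpha> ^ (n + 2) * norm \<alpha> ^ k)"
        using e[of "k + n"] by (intro mult_right_mono) auto
      finally show ?thesis
        by (simp add: algebra_simps)
    qed
    have "norm (\<Sum>k. ?f (k + n)) \<le> (\<Sum>k. norm \<alpha> ^ (n + 2) * (of_int D * norm \<alpha> ^ k))"
      by (rule norm_suminf_le[OF le sums_summable[OF geo]])
    then have "norm (\<alpha> ^ (n + 2) * remainder u n) \<le> norm \<alpha> ^ (n + 2) * (of_int D * (1 / (1 - norm \<alpha>)))"
      using sums_unique[OF tail] sums_unique[OF geo] by simp
    then have "norm \<alpha> ^ (n + 2) * norm (remainder u n) \<le> norm \<alpha> ^ (n + 2) * C"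
      by (simp only: norm_mult norm_power C_def) simp
    moreover have "0 < norm \<alpha> ^ (n + 2)"
      using a0 by simp
    ultimately show ?thesis
      by (rule mult_left_le_imp_le)
  qed
  define W where "W = C / \<bar>Im \<alpha>\<bar>"
  have w: "\<bar>of_int (u (n + 1)) - \<beta> * of_int (u (n + 2))\<bar> \<le> W" for n
  proof -
    have "Im (remainder u n) = Im \<alpha> * (of_int (u (n + 1)) - \<beta> * of_int (u (n + 2)))"
      by (simp add: remainder_def)
    then have "\<bar>Im \<alpha>\<bar> * \<bar>of_int (u (n + 1)) - \<beta> * of_int (u (n + 2))\<bar> \<le> C"
      using abs_Im_le_cmod[of "remainder u n"] rem[of n] by (simp add: abs_mult)
    then show ?thesis
      using Im_alpha by (simp add: W_def field_simps)
  qed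
  define K where "K = max \<bar>of_int (u 1)\<bar> (W / (\<beta> - 1))"
  have K: "W + K \<le> \<beta> * K"
  proof -
    have "W / (\<beta> - 1) \<le> K"
      by (simp add: K_def)
    then show ?thesis
      using beta_gt_1 by (simp add: field_simps)
  qed
  have bnd: "\<bar>of_int (u (n + 1))\<bar> \<le> K" for n
  proof (induction n)
    case 0
    then show ?case
      by (simp add: K_def)
  next
    case (Suc n)
    have "\<beta> * \<bar>of_int (u (n + 2))\<bar> = \<bar>\<beta> * of_int (u (n + 2))\<bar>"
      using beta_gt_1 by (simp add: abs_mult)
    also have "\<dots> \<le> W + K"
      using w[of n] Suc by linarith
    also have "\<dots> \<le> \<beta> * K"
      by (rule K)
    finally show ?case
      using beta_gt_1 by simp
  qed
  have "\<bar>u n\<bar> \<le> max \<bar>u 0\<bar> \<lceil>K\<rceil>" for n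
  proof (cases n)
    case (Suc m)
    have "of_int \<bar>u (m + 1)\<bar> \<le> K"
      using bnd[of m] by simp
    then have "\<bar>u (m + 1)\<bar> \<le> \<lceil>K\<rceil>"
      by linarith
    then show ?thesis
      using Suc by simp
  qed simp
  then show ?thesis
    using that by blast
qed

lemma summable_digits:
  assumes "\<And>n. c n \<le> a - 1"
  shows "summable (\<lambda>k. of_nat (c k) * \<alpha> ^ (k + 2))"
    and "norm (digit_value \<alpha> c) \<le> (\<Sum>k. real (a - 1) * norm \<alpha> ^ (k + 2))"
proof -
  have sm: "summable (\<lambda>k. real (a - 1) * norm \<alpha> ^ (k + 2))"
    using norm_alpha by (intro summable_mult summable_ignore_initial_segment summable_geometric) simp
  have le: "norm (of_nat (c k) * \<alpha> ^ (k + 2)) \<le> real (a - 1) * norm \<alpha> ^ (k + 2)" for k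
    using assms[of k] unfolding norm_mult norm_power norm_of_nat
    by (intro mult_right_mono) (auto simp del: of_nat_diff)
  show "summable (\<lambda>k. of_nat (c k) * \<alpha> ^ (k + 2))"
    by (rule summable_comparison_test[OF _ sm]) (use le in auto)
  show "norm (digit_value \<alpha> c) \<le> (\<Sum>k. real (a - 1) * norm \<alpha> ^ (k + 2))"
    unfolding digit_value_def by (rule norm_suminf_le[OF le sm])
qed

text \<open>A common point fixes the digit differences, from which the carries are computed recursively;
  conversely, for bounded carries the series of digit differences converges to the vector.\<close>

lemma tile_meets_translate:
  fixes P :: "(nat \<Rightarrow> nat) \<Rightarrow> bool"
  assumes P: "\<And>c n. P c \<Longrightarrow> c n \<le> a - 1"
  defines "T \<equiv> {digit_value \<alpha> c | c. P c}"
  shows "T \<inter> translate T (carry_value \<alpha> p q r) \<noteq> {} \<longleftrightarrow>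
    (\<exists>u B c d. u 0 = p \<and> u 1 = q \<and> u 2 = r \<and> (\<forall>n. \<bar>u n\<bar> \<le> B) \<and> P c \<and> P d \<and>
      (\<forall>n. digit_diff a u n = int (c n) - int (d n)))"
    (is "_ \<longleftrightarrow> ?R")
proof
  let ?v = "carry_value \<alpha> p q r"
  have diff: "(\<lambda>k. of_int (int (c k) - int (d k)) * \<alpha> ^ (k + 2)) sums (digit_value \<alpha> c - digit_value \<alpha> d)"
    if "P c" "P d" for c d
  proof -
    have "(\<lambda>k. of_nat (x k) * \<alpha> ^ (k + 2)) sums digit_value \<alpha> x" if "P x" for x
      unfolding digit_value_def by (rule summable_sums[OF summable_digits(1)[OF P[OF that]]])
    from sums_diff[OF this[OF that(1)] this[OF that(2)]] show ?thesis
      by (simp add: algebra_simps)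
  qed
  show ?R if meet: "T \<inter> translate T ?v \<noteq> {}"
  proof -
    obtain z where "z \<in> T" "z \<in> (\<lambda>z. z + ?v) ` T"
      using meet unfolding translate_def by blast
    then obtain c y where "P c" "z = digit_value \<alpha> c" "y \<in> T" "z = y + ?v"
      unfolding T_def by blast
    then obtain d where cd: "P c" "P d" "digit_value \<alpha> c = digit_value \<alpha> d + ?v"
      unfolding T_def by blast
    define u where "u = carries a (\<lambda>n. int (c n) - int (d n)) p q r"
    have u: "u 0 = p" "u 1 = q" "u 2 = r" "\<And>n. digit_diff a u n = int (c n) - int (d n)"
      by (simp_all add: u_def digit_diff_carries numeral_2_eq_2)
    have "\<bar>digit_diff a u n\<bar> \<le> int (a - 1)" for n
      using P[OF cd(1), of n] P[OF cd(2), of n] unfolding u(4) by linarith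
    moreover have "(\<lambda>k. of_int (digit_diff a u k) * \<alpha> ^ (k + 2)) sums carry_value \<alpha> (u 0) (u 1) (u 2)"
      using diff[OF cd(1,2)] unfolding u cd(3) by simp
    ultimately obtain B where "\<And>n. \<bar>u n\<bar> \<le> B"
      using bounded_carries by blast
    then show ?R
      using u cd by blast
  qed
  show "T \<inter> translate T ?v \<noteq> {}" if carry: ?R
  proof -
    obtain u B c d where u: "u 0 = p" "u 1 = q" "u 2 = r" "\<And>n. \<bar>u n\<bar> \<le> B" "P c" "P d"
      "\<And>n. digit_diff a u n = int (c n) - int (d n)"
      using carry by blast
    have "(\<lambda>k. of_int (int (c k) - int (d k)) * \<alpha> ^ (k + 2)) sums ?v"
      using sums_carry_value[of u B, OF u(4)] unfolding u by simp
    then have "digit_value \<alpha> c - digit_value \<alpha> d = ?v"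
      using diff[OF u(5,6)] sums_unique2 by blast
    then have "digit_value \<alpha> c = digit_value \<alpha> d + ?v"
      by (simp add: algebra_simps)
    then show ?thesis
      using u(5,6) unfolding T_def translate_def by blast
  qed
qed

lemma bounded_tile:
  assumes P: "\<And>c n. P c \<Longrightarrow> c n \<le> a - 1"
  shows "bounded {digit_value \<alpha> c | c. P c}"
  unfolding bounded_iff
proof (intro exI ballI)
  fix z assume "z \<in> {digit_value \<alpha> c | c. P c}"
  then show "norm z \<le> (\<Sum>k. real (a - 1) * norm \<alpha> ^ (k + 2))"
    using summable_digits(2) P by blast
qed

end

section \<open>Bounds for carries\<close>

text \<open>The equation for \<open>digit_diff a u j\<close> has its large coefficient at \<open>u (j + 1)\<close>, so a maximum of
  \<open>\<bar>u\<bar>\<close> can only be exploited at a positive index. The initial conditions of both tiles make this possible.\<close>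

lemma carry_max_attained:
  fixes u :: "nat \<Rightarrow> int"
  assumes "\<And>n. \<bar>u n\<bar> \<le> B"
    and 0: "\<bar>u 0\<bar> \<le> \<bar>u 2\<bar>"
  obtains j where "\<And>n. \<bar>u n\<bar> \<le> \<bar>u (j + 1)\<bar>"
proof -
  let ?S = "range (\<lambda>n. \<bar>u (n + 1)\<bar>)"
  have fin: "finite ?S"
    by (rule finite_subset[of _ "{0..B}"]) (use assms(1) in auto)
  obtain j where j: "Max ?S = \<bar>u (j + 1)\<bar>"
    using Max_in[OF fin] by blast
  have pos: "\<bar>u (n + 1)\<bar> \<le> Max ?S" for n
    by (rule Max_ge[OF fin]) blast
  have "\<bar>u n\<bar> \<le> Max ?S" for n
  proof (cases n)
    case 0
    then show ?thesis
      using assms(2) pos[of 1] by (simp add: numeral_2_eq_2)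
  next
    case (Suc m)
    then show ?thesis
      using pos[of m] by simp
  qed
  then show ?thesis
    using that[of j] unfolding j by blast
qed

text \<open>In \<open>a * digit_diff a u j + digit_diff a u (j + 1)\<close> the terms with \<open>u (j + 2)\<close> cancel, which
  leaves the coefficient \<open>a\<^sup>2 - 1\<close> at \<open>u (j + 1)\<close> against a total of \<open>2 * a\<close> at the other places.
  A single equation would only compare \<open>a\<close> with 3.\<close>

lemma carry_sup_bound:
  assumes M: "\<And>n. \<bar>u n\<bar> \<le> M"
    and j: "\<bar>u (j + 1)\<bar> = M"
    and e: "\<And>n. \<bar>digit_diff a u n\<bar> \<le> int a - 1"
  shows "(int a * int a - 1 - 2 * int a) * M \<le> int a * int a - 1"
proof -
  define A where "A = int a"
  have A0: "A \<ge> 0"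
    by (simp add: A_def)
  have e0: "\<bar>digit_diff a u j\<bar> \<le> A - 1" and e1: "\<bar>digit_diff a u (j + 1)\<bar> \<le> A - 1"
    using e unfolding A_def by blast+
  then have A1: "A \<ge> 1"
    by linarith
  have "(A * A - 1) * u (j + 1) = A * u j - (A - 1) * u (j + 3) - u (j + 4)
      - A * digit_diff a u j - digit_diff a u (j + 1)"
    by (simp add: digit_diff_def A_def algebra_simps numeral_2_eq_2 numeral_3_eq_3 eval_nat_numeral)
  then have "\<bar>(A * A - 1) * u (j + 1)\<bar> \<le> \<bar>A * u j\<bar> + \<bar>(A - 1) * u (j + 3)\<bar> + \<bar>u (j + 4)\<bar>
      + \<bar>A * digit_diff a u j\<bar> + \<bar>digit_diff a u (j + 1)\<bar>"
    by linarith
  also have "\<dots> \<le> A * M + (A - 1) * M + M + A * (A - 1) + (A - 1)"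
    unfolding abs_mult using A1 by (intro add_mono M e0 e1 mult_mono) auto
  finally have "(A * A - 1) * M \<le> A * M + (A - 1) * M + M + A * (A - 1) + (A - 1)"
    using A1 j by (simp add: abs_mult mult_le_one)
  then show ?thesis
    by (simp add: A_def algebra_simps)
qed

text \<open>For \<open>a = 2\<close> the previous inequality is void, because \<open>a\<^sup>2 - 1 < 2 * a\<close>. The combination below comes
  from the identity \<open>(1 - 2 x + x\<^sup>2 - x\<^sup>3) (4 + x - 2 x\<^sup>2 - x\<^sup>3 + x\<^sup>4 + x\<^sup>5) = 4 - 7 x - x\<^sup>8\<close>.
  The first factor is \<open>(1 - \<beta> x) (1 - \<alpha> x) (1 - cnj \<alpha> x)\<close>, the second one approximates
  \<open>4 / ((1 - \<alpha> x) (1 - cnj \<alpha> x))\<close>, and \<open>\<beta>\<close> is close to \<open>7/4\<close>.\<close>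

lemma carry_sup_bound_2:
  assumes M: "\<And>n. \<bar>u n\<bar> \<le> M"
    and j: "\<bar>u (j + 1)\<bar> = M"
    and e: "\<And>n. \<bar>digit_diff 2 u n\<bar> \<le> 1"
  shows "M \<le> 5"
proof -
  have "7 * u (j + 1) = 4 * u j - u (j + 8)
    - (4 * digit_diff 2 u j + digit_diff 2 u (j + 1) - 2 * digit_diff 2 u (j + 2)
       - digit_diff 2 u (j + 3) + digit_diff 2 u (j + 4) + digit_diff 2 u (j + 5))"
    by (simp add: digit_diff_def eval_nat_numeral)
  moreover have "u n \<le> M" "- u n \<le> M" "digit_diff 2 u n \<le> 1" "- digit_diff 2 u n \<le> 1" for n
    using M[of n] e[of n] by (simp_all add: abs_le_iff)
  note bounds = this
  ultimately have "7 * u (j + 1) \<le> 5 * M + 10" "- (7 * u (j + 1)) \<le> 5 * M + 10"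
    using bounds(1,2)[of j] bounds(1,2)[of "j + 8"] bounds(3,4)[of j] bounds(3,4)[of "j + 1"]
      bounds(3,4)[of "j + 2"] bounds(3,4)[of "j + 3"] bounds(3,4)[of "j + 4"] bounds(3,4)[of "j + 5"]
    by linarith+
  then show ?thesis
    using j by linarith
qed

text \<open>The interval for the next carry \<open>s\<close> expresses both \<open>\<bar>s\<bar> \<le> M\<close> and the bound \<open>A - 1\<close> on the digit
  difference. Computing it, instead of testing all \<open>s\<close>, keeps the evaluation small.\<close>

fun extendable :: "nat \<Rightarrow> int \<Rightarrow> int \<Rightarrow> int \<Rightarrow> int \<Rightarrow> int \<Rightarrow> bool"
  where
    "extendable 0 A M p q r = True"
  | "extendable (Suc n) A M p q r = list_ex (\<lambda>s. extendable n A M q r s)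
      [max (- M) (p - A * q + r - (A - 1))..min M (p - A * q + r + (A - 1))]"

lemma extendable_carries:
  assumes M: "\<And>n. \<bar>u n\<bar> \<le> M"
    and e: "\<And>n. \<bar>digit_diff a u n\<bar> \<le> int a - 1"
  shows "extendable n (int a) M (u j) (u (j + 1)) (u (j + 2))"
proof (induction n arbitrary: j)
  case (Suc n)
  have "u (j + 3) \<in> set [max (- M) (u j - int a * u (j + 1) + u (j + 2) - (int a - 1))
      ..min M (u j - int a * u (j + 1) + u (j + 2) + (int a - 1))]"
    using M[of "j + 3"] e[of j] by (auto simp: digit_diff_def)
  moreover have "extendable n (int a) M (u (j + 1)) (u (j + 2)) (u (j + 3))"
    using Suc[of "j + 1"] by (simp add: numeral_3_eq_3)
  ultimately show ?case
    unfolding extendable.simps list_ex_iff by blast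
qed simp

text \<open>The factor \<open>s\<close> encodes the initial condition \<open>u 0 = s * u 2\<close>, with \<open>s = -1\<close> or \<open>s = 0\<close>.\<close>

definition extendable_starts :: "nat \<Rightarrow> int \<Rightarrow> int \<Rightarrow> int \<Rightarrow> (int \<times> int) list"
  where "extendable_starts n A M s =
    filter (\<lambda>(q, r). extendable n A M (s * r) q r) (List.product [- M..M] [- M..M])"

text \<open>The ranges 5, 4, 2 are the bounds for \<open>a = 2, 3, 4\<close>, and the depths are the smallest ones at
  which every other start has died out.\<close>

lemma R_starts:
  "set (extendable_starts 9 2 5 (- 1)) \<subseteq> {- 1..1} \<times> {- 1..1}"
  "set (extendable_starts 5 3 4 (- 1)) \<subseteq> {- 1..1} \<times> {- 1..1}"
  "set (extendable_starts 2 4 2 (- 1)) \<subseteq> {- 1..1} \<times> {- 1..1}"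
  by code_simp+


text \<open>For \<open>a = 2\<close> the bound on the digit differences leaves two additional starts; they are
  incompatible with the greedy conditions only.\<close>

lemma G_starts:
  "set (extendable_starts 12 2 5 0) \<subseteq> {- 1..1} \<times> {- 1..1} - {(1, - 1), (- 1, 1)} \<union> {(1, 2), (- 1, - 2)}"
  "set (extendable_starts 6 3 4 0) \<subseteq> {- 1..1} \<times> {- 1..1} - {(1, - 1), (- 1, 1)}"
  "set (extendable_starts 3 4 2 0) \<subseteq> {- 1..1} \<times> {- 1..1} - {(1, - 1), (- 1, 1)}"
  by code_simp+

lemma exceptional_start:
  "list_all (\<lambda>s. list_all (\<lambda>t. s = 1 \<and> t = - 1 \<or> \<not> extendable 9 2 5 2 s t) [s - 4..s - 2]) [- 1..1]"
  by code_simp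

definition carry_bound :: "nat \<Rightarrow> int"
  where "carry_bound a = (if a = 2 then 5 else if a = 3 then 4 else if a = 4 then 2 else 1)"

text \<open>The inequality of lemma \<open>carry_sup_bound\<close> reads \<open>2 * M \<le> 8\<close> for \<open>a = 3\<close> and \<open>7 * M \<le> 15\<close> for
  \<open>a = 4\<close>; from \<open>a = 5\<close> on it excludes \<open>M \<ge> 2\<close>.\<close>

lemma carry_le_carry_bound:
  assumes "a \<ge> 2" "\<And>n. \<bar>u n\<bar> \<le> B" "\<bar>u 0\<bar> \<le> \<bar>u 2\<bar>"
    and e: "\<And>n. \<bar>digit_diff a u n\<bar> \<le> int a - 1"
  shows "\<bar>u n\<bar> \<le> carry_bound a"
proof -
  obtain j where max: "\<And>n. \<bar>u n\<bar> \<le> \<bar>u (j + 1)\<bar>"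
    using carry_max_attained[of u B, OF assms(2,3)] by metis
  define M where "M = \<bar>u (j + 1)\<bar>"
  have M: "\<bar>u n\<bar> \<le> M" for n
    unfolding M_def by (rule max)
  have j: "\<bar>u (j + 1)\<bar> = M"
    by (simp add: M_def)
  have ineq: "(int a * int a - 1 - 2 * int a) * M \<le> int a * int a - 1"
    by (rule carry_sup_bound[of u M j a, OF M j e])
  consider "a = 2" | "a = 3" | "a = 4" | "a \<ge> 5"
    using assms(1) by linarith
  then have "M \<le> carry_bound a"
  proof cases
    case 1
    have "M \<le> 5"
      by (rule carry_sup_bound_2[of u M j, OF M j]) (use e 1 in force)
    then show ?thesis
      using 1 by (simp add: carry_bound_def)
  next
    case 2
    have "2 * M \<le> 8"
      using ineq unfolding 2 by simp
    then show ?thesis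
      using 2 by (simp add: carry_bound_def)
  next
    case 3
    have "7 * M \<le> 15"
      using ineq unfolding 3 by simp
    then show ?thesis
      using 3 by (simp add: carry_bound_def)
  next
    case 4
    define s where "s = int a * int a"
    define A where "A = s - 1 - 2 * int a"
    have "s \<ge> 5 * int a"
      unfolding s_def using 4 by (intro mult_right_mono) auto
    moreover have "int a \<ge> 5"
      using 4 by simp
    ultimately have A: "0 \<le> A" and sA: "s - 1 < 2 * A"
      by (simp_all add: A_def)
    have "M \<le> 1"
    proof (rule ccontr)
      assume "\<not> M \<le> 1"
      then have "A * 2 \<le> A * M"
        using A by (intro mult_left_mono) auto
      also have "A * M \<le> s - 1"
        using ineq unfolding A_def s_def .
      finally show False
        using sA by simp
    qed
    then show ?thesis
      using 4 by (simp add: carry_bound_def)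
  qed
  then show ?thesis
    using M[of n] by linarith
qed

lemma start_in_extendable_starts:
  assumes "\<And>n. \<bar>u n\<bar> \<le> M" "\<And>n. \<bar>digit_diff a u n\<bar> \<le> int a - 1" "u 0 = s * u 2"
  shows "(u 1, u 2) \<in> set (extendable_starts n (int a) M s)"
  using extendable_carries[of u M a n 0, OF assms(1,2)] assms(1)[of 1] assms(1)[of 2] assms(3)
  by (simp add: extendable_starts_def abs_le_iff numeral_2_eq_2)

section \<open>Possible initial carries\<close>

lemma R_carry_starts:
  assumes a: "a \<ge> 2" and B: "\<And>n. \<bar>u n\<bar> \<le> B" and u0: "u 0 = - u 2"
    and e: "\<And>n. \<bar>digit_diff a u n\<bar> \<le> int a - 1"
  shows "(u 1, u 2) \<in> {- 1..1} \<times> {- 1..1}"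
proof -
  have M: "\<bar>u n\<bar> \<le> carry_bound a" for n
    using u0 by (intro carry_le_carry_bound[of a u B, OF a B _ e]) auto
  have st: "(u 1, u 2) \<in> set (extendable_starts n (int a) (carry_bound a) (- 1))" for n
    using u0 by (intro start_in_extendable_starts[of u, OF M e]) auto
  consider "a = 2" | "a = 3" | "a = 4" | "a \<ge> 5"
    using a by linarith
  then show ?thesis
  proof cases
    case 1
    then show ?thesis
      by (intro subsetD[OF R_starts(1)]) (use st[of 9] 1 in \<open>simp add: carry_bound_def\<close>)
  next
    case 2
    then show ?thesis
      by (intro subsetD[OF R_starts(2)]) (use st[of 5] 2 in \<open>simp add: carry_bound_def\<close>)
  next
    case 3
    then show ?thesis
      by (intro subsetD[OF R_starts(3)]) (use st[of 2] 3 in \<open>simp add: carry_bound_def\<close>)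
  next
    case 4
    then show ?thesis
      using M[of 1] M[of 2] by (auto simp: carry_bound_def)
  qed
qed

lemma digit_diff_uminus: "digit_diff a (\<lambda>n. - u n) n = - digit_diff a u n"
  by (simp add: digit_diff_def)

text \<open>From the additional start \<open>(1, 2)\<close> all carries within the bound continue with \<open>1, -1\<close>. The resulting
  digit differences \<open>-1, -1\<close> need two top digits at the very beginning of an expansion.\<close>

lemma exceptional_carry:
  assumes M: "\<And>n. \<bar>u n\<bar> \<le> 5" and e: "\<And>n. \<bar>digit_diff 2 u n\<bar> \<le> 1"
    and u: "u 0 = 0" "u 1 = 1" "u 2 = 2"
  shows "digit_diff 2 u 0 = - 1 \<and> digit_diff 2 u 1 = - 1"
proof -
  have d: "digit_diff 2 u 0 = - u 3" "digit_diff 2 u 1 = u 3 - 3 - u 4"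
    using u by (simp_all add: digit_diff_def eval_nat_numeral)
  have "extendable 9 2 5 2 (u 3) (u 4)"
    using extendable_carries[of u 5 2 9 2] M e u(3) by (simp add: eval_nat_numeral)
  moreover have "u 3 \<in> {- 1..1}" "u 4 \<in> {u 3 - 4..u 3 - 2}"
    using e[of 0] e[of 1] unfolding d by (simp_all add: abs_le_iff)
  ultimately have "u 3 = 1 \<and> u 4 = - 1"
    using exceptional_start unfolding list_all_iff set_upto by blast
  then show ?thesis
    unfolding d by simp
qed

lemma G_carry_starts:
  assumes a: "a \<ge> 2" and B: "\<And>n. \<bar>u n\<bar> \<le> B" and u0: "u 0 = 0"
    and c: "G_admissible a c" and d: "G_admissible a d"
    and cd: "\<And>n. digit_diff a u n = int (c n) - int (d n)"
  shows "(u 1, u 2) \<in> {- 1..1} \<times> {- 1..1} - {(1, - 1), (- 1, 1)}"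
proof -
  have e: "\<bar>digit_diff a u n\<bar> \<le> int a - 1" for n
    using G_admissible_le[OF c, of n] G_admissible_le[OF d, of n] a unfolding cd by linarith
  have M: "\<bar>u n\<bar> \<le> carry_bound a" for n
    using u0 by (intro carry_le_carry_bound[of a u B, OF a B _ e]) auto
  have st: "(u 1, u 2) \<in> set (extendable_starts n (int a) (carry_bound a) 0)" for n
    using u0 by (intro start_in_extendable_starts[of u, OF M e]) auto
  consider "a = 2" | "a = 3" | "a = 4" | "a \<ge> 5"
    using a by linarith
  then show ?thesis
  proof cases
    case 1
    have top: "\<not> (x 0 = 1 \<and> x 1 = 1)" if "G_admissible a x" for x
      using that 1 unfolding G_admissible_def by (auto simp: less_2_cases_iff)
    have dig: "x n \<le> 1" if "G_admissible a x" for x n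
      using G_admissible_le[OF that, of n] 1 by simp
    have M5: "\<bar>u n\<bar> \<le> 5" for n
      using M 1 by (simp add: carry_bound_def)
    have e1: "\<bar>digit_diff 2 u n\<bar> \<le> 1" for n
      using e[of n] 1 by simp
    have "(u 1, u 2) \<noteq> (1, 2)"
    proof
      assume "(u 1, u 2) = (1, 2)"
      then have "digit_diff a u 0 = - 1 \<and> digit_diff a u 1 = - 1"
        using exceptional_carry[of u, OF M5 e1] u0 1 by simp
      then have "d 0 = 1 \<and> d 1 = 1"
        using cd[of 0] cd[of 1] dig[OF d, of 0] dig[OF d, of 1] by linarith
      then show False
        using top[OF d] by blast
    qed
    moreover have "(u 1, u 2) \<noteq> (- 1, - 2)"
    proof
      assume "(u 1, u 2) = (- 1, - 2)"
      then have "digit_diff a u 0 = 1 \<and> digit_diff a u 1 = 1"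
        using exceptional_carry[of "\<lambda>n. - u n"] M5 e1 u0 1 by (simp add: digit_diff_uminus)
      then have "c 0 = 1 \<and> c 1 = 1"
        using cd[of 0] cd[of 1] dig[OF c, of 0] dig[OF c, of 1] by linarith
      then show False
        using top[OF c] by blast
    qed
    moreover have "(u 1, u 2) \<in> {- 1..1} \<times> {- 1..1} - {(1, - 1), (- 1, 1)} \<union> {(1, 2), (- 1, - 2)}"
      by (intro subsetD[OF G_starts(1)]) (use st[of 12] 1 in \<open>simp add: carry_bound_def\<close>)
    ultimately show ?thesis
      by blast
  next
    case 2
    then show ?thesis
      by (intro subsetD[OF G_starts(2)]) (use st[of 6] 2 in \<open>simp add: carry_bound_def\<close>)
  next
    case 3
    then show ?thesis
      by (intro subsetD[OF G_starts(3)]) (use st[of 3] 3 in \<open>simp add: carry_bound_def\<close>)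
  next
    case 4
    have le: "\<bar>u n\<bar> \<le> 1" for n
      using M[of n] 4 by (simp add: carry_bound_def)
    \<comment> \<open>A start \<open>(1, -1)\<close> would need \<open>u 3 \<le> -2\<close> to bring the first digit difference into range.\<close>
    have d0: "digit_diff a u 0 = - (int a * u 1) + u 2 - u 3"
      using u0 by (simp add: digit_diff_def numeral_2_eq_2)
    have "(u 1, u 2) \<noteq> (1, - 1)" "(u 1, u 2) \<noteq> (- 1, 1)"
      using e[of 0] le[of 3] unfolding d0 by auto
    then show ?thesis
      using le[of 1] le[of 2] by auto
  qed
qed

section \<open>Carries that realise the neighbors\<close>

fun alternating :: "int \<Rightarrow> int \<Rightarrow> nat \<Rightarrow> int"
  where
    "alternating p q 0 = p"
  | "alternating p q (Suc 0) = q"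
  | "alternating p q (Suc (Suc n)) = - alternating p q n"

lemma alternating_bound:
  "\<bar>p\<bar> \<le> 1 \<Longrightarrow> \<bar>q\<bar> \<le> 1 \<Longrightarrow> \<bar>alternating p q n\<bar> \<le> 1"
  by (induction p q n rule: alternating.induct) auto

lemma alternating_uminus: "alternating (- p) (- q) n = - alternating p q n"
  by (induction p q n rule: alternating.induct) auto

text \<open>A sequence of digit differences is the difference of its positive and negative parts. These
  are the smallest possible digits, and admissibility is inherited by smaller digits.\<close>

lemma R_admissible_posI:
  assumes "\<And>n. e n \<le> int a - 1"
    and "\<And>n. e (n + 1) = int a - 1 \<Longrightarrow> e (n + 2) = int a - 1 \<Longrightarrow> e n \<le> 0"
    and "\<And>n. e (n + 2) = int a - 1 \<Longrightarrow> e (n + 3) = int a - 1 \<Longrightarrow> e n \<le> 0"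
    and "a \<ge> 2"
  shows "R_admissible a (\<lambda>n. nat (e n))"
  unfolding R_admissible_def
proof (intro conjI allI impI)
  show "nat (e n) \<le> a - 1" for n
    using assms(1)[of n] by linarith
next
  fix n m assume *: "nat (e n) = a - 1 \<and> nat (e (n + 1)) = a - 1 \<and> m < n \<and> n \<le> m + 2"
  then have top: "e n = int a - 1" "e (n + 1) = int a - 1"
    using assms(4) by linarith+
  consider "n = m + 1" | "n = m + 2"
    using * by linarith
  then show "nat (e m) = 0"
  proof cases
    case 1
    then show ?thesis
      using assms(2)[of m] top by (simp add: numeral_2_eq_2)
  next
    case 2
    then show ?thesis
      using assms(3)[of m] top by (simp add: numeral_2_eq_2 numeral_3_eq_3)
  qed
qed

lemma digit_diff_alternating:
  "digit_diff a (alternating p q) n = - (int a - 1) * alternating p q (n + 1)"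
  by (simp add: digit_diff_def eval_nat_numeral algebra_simps)

text \<open>Two consecutive top digits mean two consecutive carries \<open>-1\<close>, and antiperiodicity turns
  the two preceding carries into \<open>1\<close>, so that the preceding digits of the positive part vanish.\<close>

lemma R_admissible_alternating:
  assumes "a \<ge> 2" "\<bar>p\<bar> \<le> 1" "\<bar>q\<bar> \<le> 1"
  shows "R_admissible a (\<lambda>n. nat (digit_diff a (alternating p q) n))"
proof (rule R_admissible_posI)
  let ?u = "alternating p q"
  have bd: "- 1 \<le> ?u n" for n
    using alternating_bound[OF assms(2,3), of n] by simp
  have top: "?u (n + 1) = - 1" if "- (int a - 1) * ?u (n + 1) = int a - 1" for n
  proof -
    have "(int a - 1) * (?u (n + 1) + 1) = 0"
      using that by (simp only: left_diff_distrib mult_minus_left distrib_left)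
    then show ?thesis
      using assms(1) by simp
  qed
  have A: "0 \<le> int a - 1"
    using assms(1) by simp
  show "digit_diff a ?u n \<le> int a - 1" for n
  proof -
    have "(int a - 1) * (- ?u (n + 1)) \<le> (int a - 1) * 1"
      using bd[of "n + 1"] by (intro mult_left_mono A) simp
    then show ?thesis
      unfolding digit_diff_alternating by (simp only: mult_minus_left mult_minus_right mult_1_right)
  qed
  show "digit_diff a ?u n \<le> 0"
    if "digit_diff a ?u (n + 1) = int a - 1" "digit_diff a ?u (n + 2) = int a - 1" for n
    using top[of "n + 2"] that assms(1) unfolding digit_diff_alternating by simp
  show "digit_diff a ?u n \<le> 0"
    if "digit_diff a ?u (n + 2) = int a - 1" "digit_diff a ?u (n + 3) = int a - 1" for n
    using top[of "n + 2"] that assms(1) unfolding digit_diff_alternating by simp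
qed (rule assms(1))


lemma R_carry_exists:
  assumes a: "a \<ge> 2" and xy: "\<bar>x\<bar> \<le> 1" "\<bar>y\<bar> \<le> 1"
  shows "\<exists>u B c d. u 0 = - y \<and> u 1 = x \<and> u 2 = y \<and> (\<forall>n. \<bar>u n\<bar> \<le> B) \<and>
    R_admissible a c \<and> R_admissible a d \<and> (\<forall>n. digit_diff a u n = int (c n) - int (d n))"
proof -
  let ?u = "alternating (- y) x"
  let ?e = "digit_diff a ?u"
  have "R_admissible a (\<lambda>n. nat (?e n))"
    using a xy by (intro R_admissible_alternating) auto
  moreover have "R_admissible a (\<lambda>n. nat (- ?e n))"
    using R_admissible_alternating[of a y "- x"] alternating_uminus[of "- y" x] a xy
    by (simp add: digit_diff_alternating)
  moreover have "\<forall>n. ?e n = int (nat (?e n)) - int (nat (- ?e n))"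
    by simp
  moreover have "\<forall>n. \<bar>?u n\<bar> \<le> 1"
    using alternating_bound xy by simp
  moreover have "?u 0 = - y" "?u 1 = x" "?u 2 = y"
    by (simp_all add: numeral_2_eq_2)
  ultimately show ?thesis
    by (intro exI[of _ ?u] exI[of _ 1] exI[of _ "\<lambda>n. nat (?e n)"] exI[of _ "\<lambda>n. nat (- ?e n)"] conjI)
qed

text \<open>The condition \<open>u 0 = 0\<close> breaks the antiperiodicity at the start only.\<close>

definition G_carry :: "int \<Rightarrow> int \<Rightarrow> nat \<Rightarrow> int"
  where "G_carry x y n = (if n = 0 then 0 else alternating (- y) x n)"

lemma digit_diff_G_carry:
  "digit_diff a (G_carry x y) n =
    (if n = 0 then y - (int a - 1) * x else - (int a - 1) * alternating (- y) x (n + 1))"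
  by (cases n) (simp_all add: digit_diff_def G_carry_def eval_nat_numeral algebra_simps)

lemma G_admissible_G_carry:
  assumes a: "a \<ge> 2" and xy: "(x, y) \<in> {- 1..1} \<times> {- 1..1} - {(1, - 1), (- 1, 1)}"
  shows "G_admissible a (\<lambda>n. nat (digit_diff a (G_carry x y) n))"
proof -
  let ?u = "alternating (- y) x"
  let ?e = "digit_diff a (G_carry x y)"
  have A: "int a - 1 \<ge> 1"
    using a by simp
  have xs: "- 1 \<le> x" "x \<le> 1" "- 1 \<le> y" "y \<le> 1" "\<not> (x = 1 \<and> y = - 1)" "\<not> (x = - 1 \<and> y = 1)"
    using xy by auto
  have bd: "- 1 \<le> ?u n" for n
    using alternating_bound[of "- y" x n] xs by (simp add: abs_le_iff)
  have top_u: "?u (n + 1) = - 1" if "- (int a - 1) * ?u (n + 1) = int a - 1" for n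
  proof -
    have "(int a - 1) * (?u (n + 1) + 1) = 0"
      using that by (simp only: left_diff_distrib mult_minus_left distrib_left)
    then show ?thesis
      using A by simp
  qed
  have top: "?u (n + 2) = - 1" if "?e (n + 1) = int a - 1" for n
    using that top_u[of "n + 1"] by (simp add: digit_diff_G_carry)
  have u: "?u 1 = x" "?u 2 = y" "?u 3 = - x" "?u 4 = - y" "?u (n + 4) = ?u n" for n
    by (simp_all add: eval_nat_numeral)
  have le: "?e n \<le> int a - 1" for n
  proof (cases "n = 0")
    case True
    consider "x = 1" | "x = 0" | "x = - 1"
      using xs by linarith
    then show ?thesis
      using xs A True by cases (auto simp: digit_diff_G_carry)
  next
    case False
    then show ?thesis
      using mult_left_mono[OF bd[of "n + 1"], of "int a - 1"] A
      unfolding digit_diff_G_carry mult_minus_left mult_minus_right by simp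
  qed
  have start0: "\<not> (?e 0 = int a - 1 \<and> ?e 1 = int a - 1)"
  proof
    assume *: "?e 0 = int a - 1 \<and> ?e 1 = int a - 1"
    then have "y = - 1"
      using top[of 0] u(2) by simp
    then have "x = - 1 \<or> x = 0"
      using xs by linarith
    then show False
      using * \<open>y = - 1\<close> A by (auto simp: digit_diff_G_carry)
  qed
  have start1: "\<not> (?e 1 = int a - 1 \<and> ?e 2 = int a - 1)"
  proof
    assume "?e 1 = int a - 1 \<and> ?e 2 = int a - 1"
    then have "y = - 1" "- x = - 1"
      using top[of 0] top[of 1] u(2,3) by (simp_all add: numeral_2_eq_2 numeral_3_eq_3)
    then show False
      using xs by simp
  qed
  have "R_admissible a (\<lambda>n. nat (?e n))"
  proof (rule R_admissible_posI[OF le _ _ a])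
    fix n assume *: "?e (n + 1) = int a - 1" "?e (n + 2) = int a - 1"
    show "?e n \<le> 0"
    proof (cases n)
      case 0
      then show ?thesis
        using * start1 by (simp add: numeral_2_eq_2)
    next
      case (Suc m)
      have "?u (m + 4) = - 1"
        using top[of "n + 1"] * Suc by (simp add: eval_nat_numeral)
      then have "?u (m + 2) = 1"
        by (simp add: eval_nat_numeral)
      then show ?thesis
        using Suc A by (simp add: digit_diff_G_carry)
    qed
  next
    fix n assume *: "?e (n + 2) = int a - 1" "?e (n + 3) = int a - 1"
    have t: "?u (n + 3) = - 1" "?u (n + 4) = - 1"
      using top[of "n + 1"] top[of "n + 2"] * by (simp_all add: eval_nat_numeral)
    show "?e n \<le> 0"
    proof (cases n)
      case 0
      then have "x = 1" "y = 1"
        using t u by simp_all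
      then show ?thesis
        using 0 A by (simp add: digit_diff_G_carry)
    next
      case (Suc m)
      have "?u (n + 1) = 1"
        using t(1) by (simp add: eval_nat_numeral)
      then show ?thesis
        using Suc A by (simp add: digit_diff_G_carry)
    qed
  qed
  moreover have "\<not> (nat (?e n) = a - 1 \<and> nat (?e (n + 1)) = a - 1)" if small: "n < 2" for n
  proof
    assume "nat (?e n) = a - 1 \<and> nat (?e (n + 1)) = a - 1"
    then have "?e n = int a - 1" "?e (n + 1) = int a - 1"
      using a by linarith+
    moreover have "n = 0 \<or> n = 1"
      using small by linarith
    ultimately show False
      using start0 start1 by (auto simp: numeral_2_eq_2)
  qed
  ultimately show ?thesis
    unfolding G_admissible_def by blast
qed

lemma G_carry_exists:
  assumes a: "a \<ge> 2" and xy: "(x, y) \<in> {- 1..1} \<times> {- 1..1} - {(1, - 1), (- 1, 1)}"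
  shows "\<exists>u B c d. u 0 = 0 \<and> u 1 = x \<and> u 2 = y \<and> (\<forall>n. \<bar>u n\<bar> \<le> B) \<and>
    G_admissible a c \<and> G_admissible a d \<and> (\<forall>n. digit_diff a u n = int (c n) - int (d n))"
proof -
  let ?u = "G_carry x y"
  let ?e = "digit_diff a ?u"
  have "G_admissible a (\<lambda>n. nat (?e n))"
    by (rule G_admissible_G_carry[OF a xy])
  moreover have "G_admissible a (\<lambda>n. nat (- ?e n))"
  proof -
    have "G_carry (- x) (- y) = (\<lambda>n. - ?u n)"
      using alternating_uminus[of "- y" x] by (auto simp: G_carry_def)
    then have "digit_diff a (G_carry (- x) (- y)) n = - ?e n" for n
      by (simp add: digit_diff_uminus)
    moreover have "(- x, - y) \<in> {- 1..1} \<times> {- 1..1} - {(1, - 1), (- 1, 1)}"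
      using xy by auto
    ultimately show ?thesis
      using G_admissible_G_carry[OF a, of "- x" "- y"] by simp
  qed
  moreover have "\<forall>n. ?e n = int (nat (?e n)) - int (nat (- ?e n))"
    by simp
  moreover have "\<forall>n. \<bar>?u n\<bar> \<le> 1"
    using alternating_bound[of "- y" x] xy by (auto simp: G_carry_def)
  moreover have "?u 0 = 0" "?u 1 = x" "?u 2 = y"
    by (simp_all add: G_carry_def numeral_2_eq_2)
  ultimately show ?thesis
    by (intro exI[of _ ?u] exI[of _ 1] exI[of _ "\<lambda>n. nat (?e n)"] exI[of _ "\<lambda>n. nat (- ?e n)"] conjI)
qed

section \<open>Counting the neighbors\<close>

lemma int_combination_eq_0_iff:
  assumes "Im \<alpha> \<noteq> 0"
  shows "of_int m + of_int n * \<alpha> = 0 \<longleftrightarrow> m = 0 \<and> n = 0"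
  using assms by (auto simp: complex_eq_iff)

context cubic_conjugates
begin

text \<open>Here \<open>f\<close> parametrises the lattice by \<open>(u 1, u 2)\<close>, and \<open>S\<close> collects the pairs whose
  translate meets the tile, including the zero vector.\<close>

lemma card_tile_neighbors:
  fixes f :: "int \<times> int \<Rightarrow> complex" and S :: "(int \<times> int) set"
  assumes P: "\<And>c n. P c \<Longrightarrow> c n \<le> a - 1" and T: "T = {digit_value \<alpha> c | c. P c}" and "P c"
    and inj: "inj f" and "f (0, 0) = 0" and L: "L = range f"
    and meets: "\<And>p. T \<inter> translate T (f p) \<noteq> {} \<longleftrightarrow> p \<in> S"
  shows "card (neighbors T L) = card (S - {(0, 0)}) \<and> card (neighbor_vectors T L) = card (S - {(0, 0)})"
proof -
  have zero: "f p = 0 \<longleftrightarrow> p = (0, 0)" for p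
    using inj_eq[OF inj, of p "(0, 0)"] \<open>f (0, 0) = 0\<close> by simp
  have "neighbor_vectors T L = f ` (S - {(0, 0)})"
  proof (intro equalityI subsetI)
    fix v assume v: "v \<in> neighbor_vectors T L"
    then obtain p where "v = f p"
      unfolding neighbor_vectors_def L by blast
    with v have "p \<noteq> (0, 0)" "p \<in> S"
      using zero[of p] meets[of p] unfolding neighbor_vectors_def by simp_all
    then show "v \<in> f ` (S - {(0, 0)})"
      using \<open>v = f p\<close> by simp
  next
    fix v assume "v \<in> f ` (S - {(0, 0)})"
    then obtain p where "p \<in> S" "p \<noteq> (0, 0)" "v = f p"
      by blast
    then show "v \<in> neighbor_vectors T L"
      using zero[of p] meets[of p] unfolding neighbor_vectors_def L by simp
  qed
  then have "card (neighbor_vectors T L) = card (S - {(0, 0)})"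
    using card_image[OF inj_on_subset[OF inj subset_UNIV]] by simp
  moreover have "bounded T"
    unfolding T by (rule bounded_tile) (rule P)
  moreover have "T \<noteq> {}"
    using \<open>P c\<close> unfolding T by blast
  ultimately show ?thesis
    using card_neighbors[of T L] by simp
qed

lemma card_R_neighbors:
  fixes L
  defines "L \<equiv> int_span2 (\<alpha> - 1) (\<alpha> * (\<alpha> - 1))"
  shows "card (neighbors (R_tile a \<alpha>) L) = 8 \<and> card (neighbor_vectors (R_tile a \<alpha>) L) = 8"
proof -
  let ?S = "{- 1..1} \<times> {- 1..1} :: (int \<times> int) set"
  define f where "f = (\<lambda>(x, y). carry_value \<alpha> (- y) x y)"
  have f: "f (x, y) = (1 - \<alpha>) * (of_int x + of_int y * \<alpha>)" for x y
    by (simp add: f_def carry_value_def algebra_simps power2_eq_square)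
  have inj: "inj f"
  proof (rule injI)
    fix p q assume "f p = f q"
    moreover have "\<alpha> \<noteq> 1"
      using Im_alpha by auto
    ultimately have "of_int (fst p) + of_int (snd p) * \<alpha> = of_int (fst q) + of_int (snd q) * \<alpha>"
      using f[of "fst p" "snd p"] f[of "fst q" "snd q"] unfolding prod.collapse by simp
    then have "of_int (fst p - fst q) + of_int (snd p - snd q) * \<alpha> = 0"
      by (simp add: algebra_simps)
    then show "p = q"
      unfolding int_combination_eq_0_iff[OF Im_alpha] by (simp add: prod_eq_iff)
  qed
  have range: "L = range f"
  proof (intro equalityI subsetI)
    fix z assume "z \<in> L"
    then obtain m n where "z = of_int m * (\<alpha> - 1) + of_int n * (\<alpha> * (\<alpha> - 1))"
      unfolding L_def int_span2_def by blast
    then have "z = f (- m, - n)"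
      by (simp add: f algebra_simps)
    then show "z \<in> range f"
      by blast
  next
    fix z assume "z \<in> range f"
    then obtain x y where "z = f (x, y)"
      by auto
    then have "z = of_int (- x) * (\<alpha> - 1) + of_int (- y) * (\<alpha> * (\<alpha> - 1))"
      by (simp add: f algebra_simps)
    then show "z \<in> L"
      unfolding L_def int_span2_def by blast
  qed
  have meets: "R_tile a \<alpha> \<inter> translate (R_tile a \<alpha>) (f p) \<noteq> {} \<longleftrightarrow> p \<in> ?S" for p
  proof -
    obtain x y where p: "p = (x, y)"
      by (cases p)
    have "R_tile a \<alpha> \<inter> translate (R_tile a \<alpha>) (f p) \<noteq> {} \<longleftrightarrow>
      (\<exists>u B c d. u 0 = - y \<and> u 1 = x \<and> u 2 = y \<and> (\<forall>n. \<bar>u n\<bar> \<le> B) \<and> R_admissible a c \<and> R_admissible a d \<and>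
        (\<forall>n. digit_diff a u n = int (c n) - int (d n)))"
      unfolding p f_def prod.case R_tile_eq[OF a_ge_2]
      by (rule tile_meets_translate) (rule R_admissible_le)
    also have "\<dots> \<longleftrightarrow> p \<in> ?S"
    proof
      assume "\<exists>u B c d. u 0 = - y \<and> u 1 = x \<and> u 2 = y \<and> (\<forall>n. \<bar>u n\<bar> \<le> B) \<and> R_admissible a c \<and> R_admissible a d \<and>
        (\<forall>n. digit_diff a u n = int (c n) - int (d n))"
      then obtain u B c d where u: "u 0 = - y" "u 1 = x" "u 2 = y" "\<And>n. \<bar>u n\<bar> \<le> B"
        "R_admissible a c" "R_admissible a d" "\<And>n. digit_diff a u n = int (c n) - int (d n)"
        by blast
      have "\<bar>digit_diff a u n\<bar> \<le> int a - 1" for n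
        using R_admissible_le[OF u(5), of n] R_admissible_le[OF u(6), of n] a_ge_2 unfolding u(7) by linarith
      then show "p \<in> ?S"
        using R_carry_starts[of a u B, OF a_ge_2 u(4)] u(1-3) unfolding p by simp
    next
      assume "p \<in> ?S"
      then show "\<exists>u B c d. u 0 = - y \<and> u 1 = x \<and> u 2 = y \<and> (\<forall>n. \<bar>u n\<bar> \<le> B) \<and> R_admissible a c \<and> R_admissible a d \<and>
        (\<forall>n. digit_diff a u n = int (c n) - int (d n))"
        unfolding p by (intro R_carry_exists a_ge_2) auto
    qed
    finally show ?thesis .
  qed
  have f0: "f (0, 0) = 0"
    by (simp add: f)
  have zero: "R_admissible a (\<lambda>_. 0)"
    by (simp add: R_admissible_def)
  have "card (neighbors (R_tile a \<alpha>) L) = card (?S - {(0, 0)}) \<and>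
      card (neighbor_vectors (R_tile a \<alpha>) L) = card (?S - {(0, 0)})"
  proof (rule card_tile_neighbors[where P = "R_admissible a" and c = "\<lambda>_. 0" and f = f])
    show "c n \<le> a - 1" if "R_admissible a c" for c n
      using that by (rule R_admissible_le)
  qed (fact R_tile_eq[OF a_ge_2] zero inj f0 range meets)+
  moreover have "card (?S - {(0, 0)}) = 8"
    by (simp add: card_Diff_singleton_if)
  ultimately show ?thesis
    by simp
qed

lemma card_G_neighbors:
  fixes L
  defines "L \<equiv> int_span2 1 \<alpha>"
  shows "card (neighbors (G_tile a \<alpha>) L) = 6 \<and> card (neighbor_vectors (G_tile a \<alpha>) L) = 6"
proof -
  let ?S = "{- 1..1} \<times> {- 1..1} - {(1, - 1), (- 1, 1)} :: (int \<times> int) set"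
  define f where "f = (\<lambda>(x, y). carry_value \<alpha> 0 x y)"
  have f: "f (x, y) = of_int x + of_int (y - x) * \<alpha>" for x y
    by (simp add: f_def carry_value_def algebra_simps)
  have inj: "inj f"
  proof (rule injI)
    fix p q assume "f p = f q"
    then have "of_int (fst p) + of_int (snd p - fst p) * \<alpha> = of_int (fst q) + of_int (snd q - fst q) * \<alpha>"
      using f[of "fst p" "snd p"] f[of "fst q" "snd q"] unfolding prod.collapse by simp
    then have "of_int (fst p - fst q) + of_int ((snd p - fst p) - (snd q - fst q)) * \<alpha> = 0"
      by (simp add: algebra_simps)
    then show "p = q"
      unfolding int_combination_eq_0_iff[OF Im_alpha] by (simp add: prod_eq_iff)
  qed
  have range: "L = range f"
  proof (intro equalityI subsetI)
    fix z assume "z \<in> L"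
    then obtain m n where "z = of_int m * 1 + of_int n * \<alpha>"
      unfolding L_def int_span2_def by blast
    then have "z = f (m, m + n)"
      by (simp add: f)
    then show "z \<in> range f"
      by blast
  next
    fix z assume "z \<in> range f"
    then obtain x y where "z = f (x, y)"
      by auto
    then have "z = of_int x * 1 + of_int (y - x) * \<alpha>"
      by (simp add: f)
    then show "z \<in> L"
      unfolding L_def int_span2_def by blast
  qed
  have meets: "G_tile a \<alpha> \<inter> translate (G_tile a \<alpha>) (f p) \<noteq> {} \<longleftrightarrow> p \<in> ?S" for p
  proof -
    obtain x y where p: "p = (x, y)"
      by (cases p)
    have "G_tile a \<alpha> \<inter> translate (G_tile a \<alpha>) (f p) \<noteq> {} \<longleftrightarrow>
      (\<exists>u B c d. u 0 = 0 \<and> u 1 = x \<and> u 2 = y \<and> (\<forall>n. \<bar>u n\<bar> \<le> B) \<and> G_admissible a c \<and> G_admissible a d \<and>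
        (\<forall>n. digit_diff a u n = int (c n) - int (d n)))"
      unfolding p f_def prod.case G_tile_eq
      by (rule tile_meets_translate) (rule G_admissible_le)
    also have "\<dots> \<longleftrightarrow> p \<in> ?S"
    proof
      assume "\<exists>u B c d. u 0 = 0 \<and> u 1 = x \<and> u 2 = y \<and> (\<forall>n. \<bar>u n\<bar> \<le> B) \<and> G_admissible a c \<and> G_admissible a d \<and>
        (\<forall>n. digit_diff a u n = int (c n) - int (d n))"
      then obtain u B c d where u: "u 0 = 0" "u 1 = x" "u 2 = y" "\<And>n. \<bar>u n\<bar> \<le> B"
        "G_admissible a c" "G_admissible a d" "\<And>n. digit_diff a u n = int (c n) - int (d n)"
        by blast
      show "p \<in> ?S"
        using G_carry_starts[of a u B c d, OF a_ge_2 u(4,1,5,6,7)] unfolding u(2,3) p .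
    next
      assume "p \<in> ?S"
      then show "\<exists>u B c d. u 0 = 0 \<and> u 1 = x \<and> u 2 = y \<and> (\<forall>n. \<bar>u n\<bar> \<le> B) \<and> G_admissible a c \<and> G_admissible a d \<and>
        (\<forall>n. digit_diff a u n = int (c n) - int (d n))"
        unfolding p by (intro G_carry_exists a_ge_2)
    qed
    finally show ?thesis .
  qed
  have f0: "f (0, 0) = 0"
    by (simp add: f)
  have zero: "G_admissible a (\<lambda>_. 0)"
    using a_ge_2 by (auto simp: G_admissible_def R_admissible_def)
  have "card (neighbors (G_tile a \<alpha>) L) = card (?S - {(0, 0)}) \<and>
      card (neighbor_vectors (G_tile a \<alpha>) L) = card (?S - {(0, 0)})"
  proof (rule card_tile_neighbors[where P = "G_admissible a" and c = "\<lambda>_. 0" and f = f])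
    show "c n \<le> a - 1" if "G_admissible a c" for c n
      using that by (rule G_admissible_le)
  qed (fact G_tile_eq zero inj f0 range meets)+
  moreover have "card (?S - {(0, 0)}) = 6"
    by (simp add: card_Diff_subset card_Diff_singleton_if)
  ultimately show ?thesis
    by simp
qed

end

theorem mainTheorem1:
  fixes a :: nat and \<beta> :: real and \<alpha> \<gamma> :: complex
  assumes "a \<ge> 2"
    and "\<forall>x::complex. x ^ 3 - of_nat a * x ^ 2 + x - 1 = (x - of_real \<beta>) * (x - \<alpha>) * (x - \<gamma>)"
    and "\<beta> > 1" and "\<alpha> \<notin> \<real>" and "\<gamma> \<notin> \<real>" and "\<gamma> = cnj \<alpha>" and "norm \<alpha> < 1"
  shows "card (neighbors (R_tile a \<alpha>) (int_span2 (\<alpha> - 1) (\<alpha> * (\<alpha> - 1)))) = 8 \<and>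
         card (neighbor_vectors (R_tile a \<alpha>) (int_span2 (\<alpha> - 1) (\<alpha> * (\<alpha> - 1)))) = 8 \<and>
         card (neighbors (G_tile a \<alpha>) (int_span2 1 \<alpha>)) = 6 \<and>
         card (neighbor_vectors (G_tile a \<alpha>) (int_span2 1 \<alpha>)) = 6"
proof -
  define b where "b = complex_of_real \<beta>"
  define g where "g = cnj \<alpha>"
  have fac: "x ^ 3 - of_nat a * x ^ 2 + x - 1 = (x - b) * (x - \<alpha>) * (x - g)" for x
    using assms(2,6) unfolding b_def g_def by blast
  have e3: "b * \<alpha> * g = 1"
    using fac[of 0] by (simp add: algebra_simps)
  have s: "1 - (b + \<alpha> + g) + (b * \<alpha> + b * g + \<alpha> * g) - b * \<alpha> * g = 1 - of_nat a"
    using fac[of 1] by (simp add: algebra_simps)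
  have t: "1 + (b + \<alpha> + g) + (b * \<alpha> + b * g + \<alpha> * g) + b * \<alpha> * g = 3 + of_nat a"
  proof -
    have "(- 1 - b) * (- 1 - \<alpha>) * (- 1 - g) = - 3 - of_nat a"
      using fac[of "- 1"] by (simp add: power3_eq_cube)
    then show ?thesis
      by algebra
  qed
  have e1: "b + \<alpha> + g = of_nat a"
    using s t e3 by algebra
  have e2: "b * \<alpha> + b * g + \<alpha> * g = 1"
    using s t e3 by algebra
  interpret cubic_conjugates a \<beta> \<alpha>
    by unfold_locales
      (use assms e1 e2 e3 in \<open>simp_all add: b_def g_def complex_is_Real_iff\<close>)
  show ?thesis
    using card_R_neighbors card_G_neighbors by simp
qed

end
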